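(* Let $E$ be a compact metric space with Borel $\sigma$-field $\mathcal{A}$, $T:E\to E$ continuous, $\mu$ a $T$-invariant Borel probability measure such that $(E,\mathcal{A},\mu,T)$ is uniquely ergodic, $f:E\to[0,1]$ continuous with $\int_Ef\,d\mu=\frac12$ and $a=\int_E4f(1-f)\,d\mu>0$, and let $J>0$. For $\beta>0$ put $$G_\beta(s)=\frac{\beta J}{2}s^2-\int_E\log\big(f(y)e^{\beta Js}+(1-f(y))e^{-\beta Js}\big)\,d\mu(y),\qquad s\in\mathbb{R},$$ and let $\beta_c=\sup\{\beta>0:\ G_\beta(s)\ge0\text{ for all }s\in\mathbb{R}\}$. Then $$\frac1J\le\beta_c\le\frac1{Ja}.$$ Furthermore, if $0<\beta<\beta_c$, then $G_\beta$ has a unique (global) minimum, at the point $0$.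
   Context: Uniquely ergodic: $\mu$ is the only $T$-invariant Borel probability measure on $E$. *)

theory Defs
  imports "HOL-Probability.Probability"
begin

text \<open>The space \<open>E\<close> is the universe of a metric-space type; its compactness is a hypothesis
  wherever it is needed. Invariance means that \<open>\<nu> (T -` A) = \<nu> A\<close> for all Borel \<open>A\<close>.\<close>

definition invariant_borel_prob ::
    "('a::metric_space \<Rightarrow> 'a) \<Rightarrow> 'a measure \<Rightarrow> bool" where
  "invariant_borel_prob T \<nu> \<longleftrightarrow>
     prob_space \<nu> \<and> sets \<nu> = sets borel \<and> T \<in> measurable \<nu> \<nu> \<and> distr \<nu> \<nu> T = \<nu>"

definition uniquely_ergodic ::
    "('a::metric_space \<Rightarrow> 'a) \<Rightarrow> 'a measure \<Rightarrow> bool" where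
  "uniquely_ergodic T \<mu> \<longleftrightarrow>
     invariant_borel_prob T \<mu> \<and> (\<forall>\<nu>. invariant_borel_prob T \<nu> \<longrightarrow> \<nu> = \<mu>)"

definition G_fun ::
    "'a measure \<Rightarrow> ('a \<Rightarrow> real) \<Rightarrow> real \<Rightarrow> real \<Rightarrow> real \<Rightarrow> real" where
  "G_fun \<mu> f J \<beta> s =
     \<beta> * J / 2 * s\<^sup>2
     - (\<integral>y. ln (f y * exp (\<beta> * J * s) + (1 - f y) * exp (- (\<beta> * J * s))) \<partial>\<mu>)"

text \<open>The supremum is taken in the extended reals, so that its finiteness is part of any
  bound on it rather than an artefact of the conventions for \<^term>\<open>Sup\<close> on \<^typ>\<open>real\<close>.\<close>

definition beta_c :: "'a measure \<Rightarrow> ('a \<Rightarrow> real) \<Rightarrow> real \<Rightarrow> ereal" where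
  "beta_c \<mu> f J = Sup (ereal ` {\<beta>. \<beta> > 0 \<and> (\<forall>s. G_fun \<mu> f J \<beta> s \<ge> 0)})"

end

theory Submission imports Defs begin

text \<open>Put \<open>L u = \<integral> ln (f e\<^sup>u + (1 - f) e\<^sup>-\<^sup>u) d\<mu>\<close>. With \<open>u = \<beta> J s\<close> one has
  \<open>G\<^sub>\<beta>(s) = u\<^sup>2 / (2 \<beta> J) - L u\<close>, so \<open>G\<^sub>\<beta> \<ge> 0\<close> means \<open>L u \<le> u\<^sup>2 / (2 \<beta> J)\<close> for all \<open>u\<close>, a condition
  which becomes strictly weaker off \<open>u = 0\<close> as \<open>\<beta>\<close> decreases; this gives the uniqueness of the
  minimum. Hoeffding's lemma for a two-point distribution gives \<open>L u \<le> u\<^sup>2 / 2\<close>, hence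
  \<open>\<beta>\<^sub>c \<ge> 1 / J\<close>. For the upper bound, \<open>L u + L (- u) = \<integral> ln (1 + 4 f (1 - f) sinh\<^sup>2 u) d\<mu> \<ge> a tanh\<^sup>2 u\<close>,
  and one lets \<open>u\<close> tend to \<open>0\<close>.\<close>

text \<open>The moment generating function at \<open>u\<close> of a variable that is 1 with
  probability \<open>p\<close> and -1 otherwise; its mean is \<open>2 * p - 1\<close> and its
  variance \<open>4 * p * (1 - p)\<close>.\<close>

definition two_point_mgf :: "real \<Rightarrow> real \<Rightarrow> real" where
  "two_point_mgf p u = p * exp u + (1 - p) * exp (- u)"

definition log_mgf :: "'a measure \<Rightarrow> ('a \<Rightarrow> real) \<Rightarrow> real \<Rightarrow> real" where
  "log_mgf M f u = (\<integral>y. ln (two_point_mgf (f y) u) \<partial>M)"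

lemma G_fun_eq_log_mgf:
  assumes "\<beta> > 0" "J > 0"
  shows "G_fun M f J \<beta> s = (\<beta> * J * s)\<^sup>2 / (2 * (\<beta> * J)) - log_mgf M f (\<beta> * J * s)"
  using assms by (simp add: G_fun_def log_mgf_def two_point_mgf_def power2_eq_square)

lemma G_fun_nonneg_iff:
  assumes "\<beta> > 0" "J > 0"
  shows "(\<forall>s. G_fun M f J \<beta> s \<ge> 0) \<longleftrightarrow> (\<forall>u. log_mgf M f u \<le> u\<^sup>2 / (2 * (\<beta> * J)))"
proof safe
  fix u assume "\<forall>s. G_fun M f J \<beta> s \<ge> 0"
  then have "G_fun M f J \<beta> (u / (\<beta> * J)) \<ge> 0" ..
  then show "log_mgf M f u \<le> u\<^sup>2 / (2 * (\<beta> * J))"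
    using assms by (simp add: G_fun_eq_log_mgf)
qed (simp add: G_fun_eq_log_mgf[OF assms])

lemma two_point_mgf_bounds:
  assumes "p \<in> {0..1}"
  shows "exp (- \<bar>u\<bar>) \<le> two_point_mgf p u" "two_point_mgf p u \<le> exp \<bar>u\<bar>"
proof -
  have "p * exp (- \<bar>u\<bar>) + (1 - p) * exp (- \<bar>u\<bar>) \<le> two_point_mgf p u"
    unfolding two_point_mgf_def using assms by (intro add_mono mult_left_mono) auto
  then show "exp (- \<bar>u\<bar>) \<le> two_point_mgf p u" by (simp add: algebra_simps)
  have "two_point_mgf p u \<le> p * exp \<bar>u\<bar> + (1 - p) * exp \<bar>u\<bar>"
    unfolding two_point_mgf_def using assms by (intro add_mono mult_left_mono) auto
  then show "two_point_mgf p u \<le> exp \<bar>u\<bar>" by (simp add: algebra_simps)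
qed

lemma two_point_mgf_pos: "p \<in> {0..1} \<Longrightarrow> two_point_mgf p u > 0"
  using two_point_mgf_bounds(1)[of p u] exp_gt_zero[of "- \<bar>u\<bar>"] by linarith

text \<open>A bound uniform in \<open>p\<close>, which makes the integrand of \<open>log_mgf\<close>
  integrable over a probability space.\<close>

lemma abs_ln_two_point_mgf_le:
  assumes "p \<in> {0..1}"
  shows "\<bar>ln (two_point_mgf p u)\<bar> \<le> \<bar>u\<bar>"
proof -
  have "ln (exp (- \<bar>u\<bar>)) \<le> ln (two_point_mgf p u)" "ln (two_point_mgf p u) \<le> ln (exp \<bar>u\<bar>)"
    using two_point_mgf_bounds[OF assms, of u] two_point_mgf_pos[OF assms, of u]
    by (simp_all only: ln_le_cancel_iff exp_gt_zero)
  then show ?thesis by simp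
qed

lemma ln_two_point_mgf_le:
  assumes p: "p \<in> {0..1}"
  shows "ln (two_point_mgf p u) \<le> (2 * p - 1) * u + u\<^sup>2 / 2"
proof -
  have nonneg: "ln (two_point_mgf q v) \<le> (2 * q - 1) * v + v\<^sup>2 / 2"
    if q: "q \<in> {0..1}" and v: "v \<ge> 0" for q v :: real
  proof -
    have pos: "1 + q * (exp (2 * v) - 1) > 0"
      using q v by (intro add_pos_nonneg mult_nonneg_nonneg) auto
    \<comment> \<open>Taking out \<open>exp (- v)\<close> moves the two values from -1 and 1 to 0
      and 2, the form treated by Hoeffding's lemma with parameter \<open>2 * v\<close>; its bound
      \<open>(2 * v)\<^sup>2 / 8\<close> is \<open>v\<^sup>2 / 2\<close>.\<close>
    have "two_point_mgf q v = exp (- v) * (1 + q * (exp (2 * v) - 1))"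
      by (simp add: two_point_mgf_def algebra_simps flip: exp_add)
    then have "ln (two_point_mgf q v) = - v + ln (1 + q * (exp (2 * v) - 1))"
      using pos by (simp add: ln_mult)
    moreover have "- (2 * v) * q + ln (1 + q * (exp (2 * v) - 1)) \<le> (2 * v)\<^sup>2 / 8"
      using Hoeffdings_lemma_aux[of "2 * v" q] q v by (simp add: algebra_simps)
    ultimately show ?thesis by (simp add: algebra_simps power2_eq_square)
  qed
  show ?thesis
  proof (cases "u \<ge> 0")
    case False
    \<comment> \<open>Exchanging the two outcomes replaces \<open>p\<close> by \<open>1 - p\<close>
      and \<open>u\<close> by \<open>- u\<close>, which reduces to a nonnegative argument.\<close>
    then show ?thesis
      using nonneg[of "1 - p" "- u"] p by (simp add: two_point_mgf_def algebra_simps)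
  qed (use nonneg p in auto)
qed

lemma two_point_mgf_mult_reflect:
  "two_point_mgf p u * two_point_mgf p (- u) = 1 + 4 * p * (1 - p) * (sinh u)\<^sup>2"
proof -
  have e: "exp (- u) = inverse (exp u)" by (simp add: exp_minus)
  show ?thesis
    unfolding two_point_mgf_def sinh_def e
    by (simp add: field_simps power2_eq_square)
qed

text \<open>With \<open>x = 4 * p * (1 - p) * (sinh u)\<^sup>2\<close> the right side is
  \<open>ln (1 + x)\<close>, which is at least \<open>x / (1 + x)\<close>. Since
  \<open>4 * p * (1 - p)\<close> is at most 1, the denominator is at most
  \<open>(cosh u)\<^sup>2\<close>.\<close>

lemma ln_two_point_mgf_reflect_ge:
  assumes p: "p \<in> {0..1}"
  shows "4 * p * (1 - p) * (tanh u)\<^sup>2 \<le> ln (two_point_mgf p u) + ln (two_point_mgf p (- u))"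
proof -
  define w where "w = 4 * p * (1 - p)"
  have w0: "w \<ge> 0" using p by (simp add: w_def)
  have "w = 1 - (2 * p - 1)\<^sup>2" by (simp add: w_def power2_eq_square algebra_simps)
  then have w1: "w \<le> 1" by simp
  define x where "x = w * (sinh u)\<^sup>2"
  have x: "x \<ge> 0" "x \<le> (sinh u)\<^sup>2" using w0 w1 by (simp_all add: x_def mult_left_le_one_le)
  have "w * (tanh u)\<^sup>2 = x / (1 + (sinh u)\<^sup>2)"
    by (simp add: x_def tanh_def power_divide cosh_square_eq add.commute)
  also have "\<dots> \<le> x / (1 + x)" using x by (intro divide_left_mono) auto
  also have "\<dots> \<le> ln (1 + x)"
    using ln_add1_ge[OF x(1)] by (simp add: add.commute)
  also have "\<dots> = ln (two_point_mgf p u) + ln (two_point_mgf p (- u))"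
    unfolding x_def w_def two_point_mgf_mult_reflect[symmetric]
    using two_point_mgf_pos[OF p] by (intro ln_mult_pos) auto
  finally show ?thesis by (simp add: w_def)
qed

context prob_space
begin

lemma integrable_ln_two_point_mgf:
  assumes "f \<in> borel_measurable M" "\<And>x. f x \<in> {0..1}"
  shows "integrable M (\<lambda>y. ln (two_point_mgf (f y) u))"
proof (rule integrable_const_bound[where B = "\<bar>u\<bar>"])
  show "(\<lambda>y. ln (two_point_mgf (f y) u)) \<in> borel_measurable M"
    unfolding two_point_mgf_def using assms(1) by measurable
qed (simp add: abs_ln_two_point_mgf_le[OF assms(2)])

lemma log_mgf_le:
  assumes f: "f \<in> borel_measurable M" "\<And>x. f x \<in> {0..1}" and half: "expectation f = 1 / 2"
  shows "log_mgf M f u \<le> u\<^sup>2 / 2"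
proof -
  have int: "integrable M f"
    by (rule integrable_const_bound[where B = 1]) (use f in auto)
  have "log_mgf M f u \<le> expectation (\<lambda>y. (2 * f y - 1) * u + u\<^sup>2 / 2)"
    unfolding log_mgf_def
    by (intro integral_mono integrable_ln_two_point_mgf f ln_two_point_mgf_le) (use int in auto)
  \<comment> \<open>The linear term vanishes because \<open>f\<close> has mean 1/2.\<close>
  also have "\<dots> = u\<^sup>2 / 2" using int half by (simp add: prob_space)
  finally show ?thesis .
qed

lemma log_mgf_reflect_ge:
  assumes f: "f \<in> borel_measurable M" "\<And>x. f x \<in> {0..1}"
  shows "expectation (\<lambda>y. 4 * f y * (1 - f y)) * (tanh u)\<^sup>2 \<le> log_mgf M f u + log_mgf M f (- u)"
proof -
  have int: "integrable M (\<lambda>y. 4 * f y * (1 - f y))"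
  proof (rule integrable_const_bound[where B = 4])
    have "\<bar>4 * f x * (1 - f x)\<bar> \<le> 4" for x
      using f(2)[of x] mult_le_one[of "f x" "1 - f x"] by (simp add: abs_mult mult.assoc)
    then show "AE x in M. norm (4 * f x * (1 - f x)) \<le> 4" by simp
  qed (use f(1) in measurable)
  have "expectation (\<lambda>y. 4 * f y * (1 - f y)) * (tanh u)\<^sup>2
      = expectation (\<lambda>y. 4 * f y * (1 - f y) * (tanh u)\<^sup>2)"
    by simp
  also have "\<dots> \<le> expectation (\<lambda>y. ln (two_point_mgf (f y) u) + ln (two_point_mgf (f y) (- u)))"
    by (intro integral_mono Bochner_Integration.integrable_add integrable_ln_two_point_mgf f
        ln_two_point_mgf_reflect_ge) (use int in auto)
  also have "\<dots> = log_mgf M f u + log_mgf M f (- u)"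
    unfolding log_mgf_def
    by (intro Bochner_Integration.integral_add integrable_ln_two_point_mgf f)
  finally show ?thesis .
qed

text \<open>Adding the hypothesis at \<open>u\<close> and \<open>- u\<close> bounds the mean
  variance times \<open>(tanh u)\<^sup>2\<close> by \<open>c * u\<^sup>2\<close>. Divide by
  \<open>u\<^sup>2\<close> and let \<open>u\<close> tend to 0, where \<open>tanh u / u\<close> tends
  to the derivative 1 of \<open>tanh\<close>.\<close>

lemma mean_variance_le_if_log_mgf_le:
  assumes f: "f \<in> borel_measurable M" "\<And>x. f x \<in> {0..1}"
    and le: "\<And>u. log_mgf M f u \<le> c * u\<^sup>2 / 2"
  shows "expectation (\<lambda>y. 4 * f y * (1 - f y)) \<le> c"
proof -
  define a where "a = expectation (\<lambda>y. 4 * f y * (1 - f y))"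
  have "a * (tanh u / u)\<^sup>2 \<le> c" if "u \<noteq> 0" for u
  proof -
    have "a * (tanh u)\<^sup>2 \<le> c * u\<^sup>2"
      using log_mgf_reflect_ge[OF f, of u] le[of u] le[of "- u"] by (simp add: a_def)
    then show ?thesis using that by (simp add: power_divide field_simps)
  qed
  then have "eventually (\<lambda>u. a * (tanh u / u)\<^sup>2 \<le> c) (at 0)"
    by (simp add: eventually_at_filter)
  moreover have "((\<lambda>u::real. tanh u / u) \<longlongrightarrow> 1) (at 0)"
  proof -
    have "(tanh has_real_derivative 1) (at 0)"
      by (auto intro!: derivative_eq_intros)
    then show ?thesis by (simp add: DERIV_def)
  qed
  then have "((\<lambda>u. a * (tanh u / u)\<^sup>2) \<longlongrightarrow> a * 1\<^sup>2) (at (0::real))"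
    by (intro tendsto_intros)
  ultimately show ?thesis
    unfolding a_def[symmetric] using tendsto_upperbound[of _ "a * 1\<^sup>2" "at (0::real)" c] by simp
qed

end

theorem proposition4p1:
  fixes T :: "'a::metric_space \<Rightarrow> 'a"
    and \<mu> :: "'a measure"
    and f :: "'a \<Rightarrow> real"
    and a J :: real
  assumes "compact (UNIV :: 'a set)"
    and "continuous_on UNIV T"
    and "invariant_borel_prob T \<mu>"
    and "uniquely_ergodic T \<mu>"
    and "continuous_on UNIV f"
    and "\<And>x. f x \<in> {0..1}"
    and "(\<integral>x. f x \<partial>\<mu>) = 1 / 2"
    and "a = (\<integral>x. 4 * f x * (1 - f x) \<partial>\<mu>)"
    and "a > 0"
    and "J > 0"
  shows "ereal (1 / J) \<le> beta_c \<mu> f J \<and> beta_c \<mu> f J \<le> ereal (1 / (J * a))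
    \<and> (\<forall>\<beta>. 0 < \<beta> \<and> ereal \<beta> < beta_c \<mu> f J \<longrightarrow>
          (\<forall>s. is_arg_min (G_fun \<mu> f J \<beta>) (\<lambda>_. True) s \<longleftrightarrow> s = 0))"
proof (intro conjI allI impI)
  interpret prob_space \<mu> using assms(3) by (simp add: invariant_borel_prob_def)
  have "sets \<mu> = sets borel" using assms(3) by (simp add: invariant_borel_prob_def)
  then have meas: "f \<in> borel_measurable \<mu>"
    using borel_measurable_continuous_onI[OF assms(5)] measurable_cong_sets by blast
  note f = meas assms(6)
  have "log_mgf \<mu> f u \<le> u\<^sup>2 / 2" for u
    using log_mgf_le[OF f assms(7)] .
  \<comment> \<open>At \<open>1 / J\<close> the factor \<beta> J is 1, so the criterion is exactly
    the Hoeffding bound.\<close>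
  then have "\<forall>s. G_fun \<mu> f J (1 / J) s \<ge> 0"
    using \<open>J > 0\<close> by (subst G_fun_nonneg_iff) auto
  then show "ereal (1 / J) \<le> beta_c \<mu> f J"
    unfolding beta_c_def using \<open>J > 0\<close> by (intro Sup_upper) auto
  show "beta_c \<mu> f J \<le> ereal (1 / (J * a))"
    unfolding beta_c_def
  proof (rule Sup_least, clarify)
    fix \<beta> :: real assume \<beta>: "\<beta> > 0" "\<forall>s. G_fun \<mu> f J \<beta> s \<ge> 0"
    then have "log_mgf \<mu> f u \<le> 1 / (\<beta> * J) * u\<^sup>2 / 2" for u
      using G_fun_nonneg_iff[of \<beta> J \<mu> f] \<open>J > 0\<close> by (simp add: mult.commute)
    then have "a \<le> 1 / (\<beta> * J)"
      unfolding assms(8) by (rule mean_variance_le_if_log_mgf_le[OF f])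
    then show "ereal \<beta> \<le> ereal (1 / (J * a))"
      using \<beta> \<open>J > 0\<close> \<open>a > 0\<close> by (simp add: field_simps)
  qed
  fix \<beta> s assume "0 < \<beta> \<and> ereal \<beta> < beta_c \<mu> f J"
  \<comment> \<open>Being below the supremum gives an admissible parameter strictly above \<beta>;
    this gap is what makes the inequality strict away from 0.\<close>
  then obtain \<beta>' where \<beta>: "0 < \<beta>" "\<beta> < \<beta>'" "\<forall>s. G_fun \<mu> f J \<beta>' s \<ge> 0"
    unfolding beta_c_def by (auto simp: less_Sup_iff)
  have G0: "G_fun \<mu> f J \<beta> 0 = 0" by (simp add: G_fun_def)
  have Gpos: "G_fun \<mu> f J \<beta> t > 0" if "t \<noteq> 0" for t
  proof -
    define u where "u = \<beta> * J * t"
    have u: "u \<noteq> 0" using that \<beta> \<open>J > 0\<close> by (simp add: u_def)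
    have "log_mgf \<mu> f u \<le> u\<^sup>2 / (2 * (\<beta>' * J))"
      using G_fun_nonneg_iff[of \<beta>' J \<mu> f] \<beta> \<open>J > 0\<close> by simp
    also have "\<dots> < u\<^sup>2 / (2 * (\<beta> * J))"
      using \<beta> \<open>J > 0\<close> u by (intro divide_strict_left_mono) auto
    finally show ?thesis
      using \<beta> \<open>J > 0\<close> by (simp add: G_fun_eq_log_mgf u_def)
  qed
  show "is_arg_min (G_fun \<mu> f J \<beta>) (\<lambda>_. True) s \<longleftrightarrow> s = 0"
    unfolding is_arg_min_def using G0 Gpos by (metis less_irrefl less_asym)
qed

end
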